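(* Let $d\ge 0$, $n\ge 2$ and $0\le k\le d$ be integers, let $p\in[0,1]$, and let $C$ be the random cubical complex of the $d$-dimensional plaquette model with parameters $n$ and $p$. The expected value and variance of $\mu_k(C)$, normalized by volume, are $$\frac{1}{n^d}\mathbb{E}(\mu_k(C))=\begin{cases}(-1)^{d-k}\binom{d}{k}(p-1) & \text{if } k<d,\\ p & \text{if } k=d,\end{cases}$$ $$\frac{1}{n^d}\mathrm{Var}(\mu_k(C))=\binom{d}{k}^2(p-p^2).$$
   Context: The lattice $\mathcal{L}$ is the $d$-dimensional torus $(\mathbb{R}/n\mathbb{Z})^d$ subdivided into $n^d$ unit $d$-cubes. An open $i$-cube of $\mathcal{L}$ ($0\le i\le d$) is a product of $d$ factors, each of which is either a point $\{a\}$ or an open unit interval $(a,a+1)$ with $a\in\mathbb{Z}/n\mathbb{Z}$, with exactly $i$ factors being intervals; $\mathcal{L}$ is the disjoint union of its open cubes. Intrinsic volumes: an open $i$-cube has $k$-th intrinsic volume $(-1)^{i-k}\binom{i}{k}$ (which is $0$ if $k>i$), and if $C$ is a union of open cubes of $\mathcal{L}$ then $\mu_k(C)$ is the sum of the $k$-th intrinsic volumes of the open cubes contained in $C$. Plaquette model: all open cubes of $\mathcal{L}$ of dimension less than $d$ are included in $C$, and the open $d$-cubes of $\mathcal{L}$ are included independently, each with probability $p$. *)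

theory Defs
  imports "HOL-Probability.Probability"
begin

definition circle_rel :: "nat \<Rightarrow> (real \<times> real) set" where
  "circle_rel n = {(x, y). \<exists>m::int. y = x + of_int m * of_nat n}"

definition circle_proj :: "nat \<Rightarrow> real \<Rightarrow> real set" where
  "circle_proj n x = circle_rel n `` {x}"

definition torus :: "nat \<Rightarrow> nat \<Rightarrow> (nat \<Rightarrow> real set) set" where
  "torus n d = PiE {..<d} (\<lambda>_. UNIV // circle_rel n)"

text \<open>A factor is the point $\{a\}$ or the open interval $(a,a+1)$ of the circle; the
  integer \<open>a\<close> only matters modulo \<open>n\<close>.\<close>

definition cube_factor :: "nat \<Rightarrow> bool \<Rightarrow> int \<Rightarrow> real set set" where
  "cube_factor n b a =
     circle_proj n ` (if b then {of_int a<..<of_int a + 1} else {of_int a})"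

definition open_cubes :: "nat \<Rightarrow> nat \<Rightarrow> nat \<Rightarrow> (nat \<Rightarrow> real set) set set" where
  "open_cubes n d i =
     {PiE {..<d} (\<lambda>j. cube_factor n (j \<in> S) (a j)) | S a. S \<subseteq> {..<d} \<and> card S = i}"

text \<open>For \<open>k > i\<close> the exponent is truncated, but the binomial coefficient vanishes.\<close>

definition cube_intrinsic_volume :: "nat \<Rightarrow> nat \<Rightarrow> real" where
  "cube_intrinsic_volume i k = (-1) ^ (i - k) * of_nat (i choose k)"

definition intrinsic_volume :: "nat \<Rightarrow> nat \<Rightarrow> nat \<Rightarrow> (nat \<Rightarrow> real set) set \<Rightarrow> real" where
  "intrinsic_volume n d k C =
     (\<Sum>i\<le>d. \<Sum>Q\<in>{Q \<in> open_cubes n d i. Q \<subseteq> C}. cube_intrinsic_volume i k)"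

definition union_of_cubes :: "nat \<Rightarrow> nat \<Rightarrow> (nat \<Rightarrow> real set) set \<Rightarrow> bool" where
  "union_of_cubes n d C \<longleftrightarrow> (\<exists>\<Q>. \<Q> \<subseteq> (\<Union>i\<le>d. open_cubes n d i) \<and> C = \<Union>\<Q>)"

definition plaquette_model ::
  "'a measure \<Rightarrow> nat \<Rightarrow> nat \<Rightarrow> real \<Rightarrow> ('a \<Rightarrow> (nat \<Rightarrow> real set) set) \<Rightarrow> bool" where
  "plaquette_model M n d p C \<longleftrightarrow>
     prob_space M \<and>
     (\<forall>\<omega>\<in>space M. union_of_cubes n d (C \<omega>)) \<and>
     (\<forall>\<omega>\<in>space M. \<forall>i<d. \<forall>Q\<in>open_cubes n d i. Q \<subseteq> C \<omega>) \<and>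
     prob_space.indep_events M (\<lambda>Q. {\<omega>\<in>space M. Q \<subseteq> C \<omega>}) (open_cubes n d d) \<and>
     (\<forall>Q\<in>open_cubes n d d. measure M {\<omega>\<in>space M. Q \<subseteq> C \<omega>} = p)"

lemma equiv_circle_rel: "equiv UNIV (circle_rel n)"
proof (rule equivI)
  show "refl (circle_rel n)"
    by (auto simp: refl_on_def circle_rel_def intro: exI[of _ 0])
  show "sym (circle_rel n)"
  proof (rule symI)
    fix x y assume "(x, y) \<in> circle_rel n"
    then obtain m :: int where "y = x + of_int m * of_nat n"
      by (auto simp: circle_rel_def)
    then have "x = y + of_int (- m) * of_nat n" by simp
    then show "(y, x) \<in> circle_rel n" unfolding circle_rel_def by blast
  qed
  show "trans (circle_rel n)"
  proof (rule transI)
    fix x y z assume "(x, y) \<in> circle_rel n" "(y, z) \<in> circle_rel n"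
    then obtain l m :: int where "y = x + of_int l * of_nat n" "z = y + of_int m * of_nat n"
      by (auto simp: circle_rel_def)
    then have "z = x + of_int (l + m) * of_nat n" by (simp add: algebra_simps)
    then show "(x, z) \<in> circle_rel n" unfolding circle_rel_def by blast
  qed
qed (simp)

lemma circle_proj_eq_iff:
  "circle_proj n x = circle_proj n y \<longleftrightarrow> (\<exists>m::int. y = x + of_int m * of_nat n)"
  using eq_equiv_class_iff[OF equiv_circle_rel, of x y n]
  by (simp add: circle_proj_def circle_rel_def)

lemma circle_proj_shift: "circle_proj n (x + of_int m * of_nat n) = circle_proj n x"
  by (rule sym, subst circle_proj_eq_iff) blast

lemma cube_factor_shift: "cube_factor n b (a + m * int n) = cube_factor n b a"
proof (cases b)
  case True
  have "{of_int (a + m * int n)<..<of_int (a + m * int n) + 1 :: real} =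
        (\<lambda>x. x + of_int m * of_nat n) ` {of_int a<..<of_int a + 1}"
  proof safe
    fix x :: real assume "x \<in> {of_int (a + m * int n)<..<of_int (a + m * int n) + 1}"
    then show "x \<in> (\<lambda>x. x + of_int m * of_nat n) ` {of_int a<..<of_int a + 1}"
      by (intro image_eqI[of _ _ "x - of_int m * of_nat n"]) auto
  qed auto
  with True show ?thesis by (simp add: cube_factor_def image_image circle_proj_shift)
next
  case False
  then show ?thesis using circle_proj_shift[of n "of_int a" m] by (simp add: cube_factor_def)
qed

lemma factor_floor:
  fixes x :: real
  assumes "x \<in> (if b then {of_int a<..<of_int a + 1} else {of_int a})"
  shows "\<lfloor>x\<rfloor> = a" "b \<longleftrightarrow> x \<notin> \<int>"
proof -
  show *: "\<lfloor>x\<rfloor> = a" using assms by (intro floor_unique) (auto split: if_splits)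
  show "b \<longleftrightarrow> x \<notin> \<int>"
  proof (cases b)
    case True
    then have "x \<noteq> of_int \<lfloor>x\<rfloor>" using assms * by simp
    then show ?thesis using True by (auto elim: Ints_cases)
  qed (use assms in simp)
qed

lemma cube_factor_disjoint:
  assumes "t \<in> cube_factor n b a" "t \<in> cube_factor n b' a'"
  shows "b = b' \<and> cube_factor n b a = cube_factor n b' a'"
proof -
  obtain x where x: "t = circle_proj n x"
      "x \<in> (if b then {of_int a<..<of_int a + 1} else {of_int a})"
    using assms(1) unfolding cube_factor_def by blast
  obtain y where y: "t = circle_proj n y"
      "y \<in> (if b' then {of_int a'<..<of_int a' + 1} else {of_int a'})"
    using assms(2) unfolding cube_factor_def by blast
  obtain m :: int where m: "y = x + of_int m * of_nat n"
    using x(1) y(1) circle_proj_eq_iff[of n x y] by auto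
  then have m': "y = x + of_int (m * int n)" by simp
  have fx: "\<lfloor>x\<rfloor> = a" "b \<longleftrightarrow> x \<notin> \<int>"
    using x(2) factor_floor by blast+
  have fy: "\<lfloor>y\<rfloor> = a'" "b' \<longleftrightarrow> y \<notin> \<int>"
    using y(2) factor_floor by blast+
  have "a' = a + m * int n" using fx(1) fy(1) floor_add_int[of x "m * int n"] m' by simp
  moreover have "y \<in> \<int> \<longleftrightarrow> x \<in> \<int>"
    unfolding m' by (metis Ints_add Ints_diff Ints_of_int add_diff_cancel_right')
  ultimately show ?thesis using fx(2) fy(2) cube_factor_shift by simp
qed

lemma open_cube_disjoint:
  assumes "Q \<in> open_cubes n d i" "R \<in> open_cubes n d j" "f \<in> Q" "f \<in> R"
  shows "i = j \<and> Q = R"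
proof -
  obtain S a where Q: "Q = PiE {..<d} (\<lambda>l. cube_factor n (l \<in> S) (a l))" "S \<subseteq> {..<d}" "card S = i"
    using assms(1) unfolding open_cubes_def by blast
  obtain T b where R: "R = PiE {..<d} (\<lambda>l. cube_factor n (l \<in> T) (b l))" "T \<subseteq> {..<d}" "card T = j"
    using assms(2) unfolding open_cubes_def by blast
  have *: "(l \<in> S) = (l \<in> T) \<and> cube_factor n (l \<in> S) (a l) = cube_factor n (l \<in> T) (b l)"
    if "l < d" for l
    using PiE_mem[OF assms(3)[unfolded Q(1)]] PiE_mem[OF assms(4)[unfolded R(1)]] that
    by (intro cube_factor_disjoint[of "f l"]) simp_all
  then have "S = T" using Q(2) R(2) by (auto dest: subsetD)
  moreover have "Q = R" unfolding Q(1) R(1)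
    by (rule PiE_cong) (rule *[THEN conjunct2], simp)
  ultimately show ?thesis using Q(3) R(3) by simp
qed

lemma open_cube_nonempty: "Q \<in> open_cubes n d i \<Longrightarrow> Q \<noteq> {}"
  by (auto simp: open_cubes_def PiE_eq_empty_iff cube_factor_def split: if_splits)

lemma finite_open_cubes:
  assumes "n > 0" shows "finite (open_cubes n d i)"
proof (rule finite_subset)
  let ?F = "(\<lambda>(b, a). cube_factor n b a) ` (UNIV \<times> {0..<int n})"
  have "cube_factor n b a \<in> ?F" for b a
  proof (rule image_eqI)
    show "cube_factor n b a = (case (b, a mod int n) of (b, a) \<Rightarrow> cube_factor n b a)"
      using cube_factor_shift[of n b "a mod int n" "a div int n"] by simp
  qed (use assms in auto)
  then have F: "(\<lambda>j\<in>{..<d}. cube_factor n (j \<in> S) (a j)) \<in> PiE {..<d} (\<lambda>_. ?F)" for S a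
    by (intro restrict_PiE_iff[THEN iffD2]) blast
  show "open_cubes n d i \<subseteq> PiE {..<d} ` PiE {..<d} (\<lambda>_. ?F)"
  proof
    fix Q assume "Q \<in> open_cubes n d i"
    then obtain S a where "Q = PiE {..<d} (\<lambda>j. cube_factor n (j \<in> S) (a j))"
      unfolding open_cubes_def by blast
    also have "\<dots> = PiE {..<d} (\<lambda>j\<in>{..<d}. cube_factor n (j \<in> S) (a j))"
      by (rule PiE_cong) auto
    finally show "Q \<in> PiE {..<d} ` PiE {..<d} (\<lambda>_. ?F)" using F by blast
  qed
  show "finite (PiE {..<d} ` PiE {..<d} (\<lambda>_. ?F))"
    by (intro finite_imageI finite_PiE) auto
qed

lemma torus_eq_Union_open_cubes: "torus n d = (\<Union>i\<le>d. \<Union>(open_cubes n d i))"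
proof safe
  fix f assume f: "f \<in> torus n d"
  have "\<exists>x. f j = circle_proj n x" if "j < d" for j
    using f that by (auto simp: torus_def PiE_iff quotient_def circle_proj_def)
  then obtain x where x: "\<And>j. j < d \<Longrightarrow> f j = circle_proj n (x j)" by metis
  define S where "S = {j. j < d \<and> x j \<notin> \<int>}"
  have "f j \<in> cube_factor n (j \<in> S) \<lfloor>x j\<rfloor>" if "j < d" for j
  proof -
    have "x j \<noteq> of_int \<lfloor>x j\<rfloor>" if "x j \<notin> \<int>" using that by (metis Ints_of_int)
    then have "of_int \<lfloor>x j\<rfloor> < x j" if "x j \<notin> \<int>"
      using that of_int_floor_le[of "x j"] by linarith
    then show ?thesis
      unfolding cube_factor_def x[OF that]
      by (intro imageI) (use that in \<open>auto simp: S_def elim: Ints_cases\<close>)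
  qed
  then have 1: "f \<in> PiE {..<d} (\<lambda>j. cube_factor n (j \<in> S) \<lfloor>x j\<rfloor>)" (is "_ \<in> ?Q")
    using f by (auto simp: torus_def PiE_iff)
  have S: "S \<subseteq> {..<d}" by (auto simp: S_def)
  then have 2: "card S \<le> d" using card_mono[of "{..<d}" S] by simp
  have "?Q \<in> open_cubes n d (card S)"
    unfolding open_cubes_def mem_Collect_eq
    by (rule exI[of _ S], rule exI[of _ "\<lambda>j. \<lfloor>x j\<rfloor>"]) (use S in simp)
  then show "f \<in> (\<Union>i\<le>d. \<Union>(open_cubes n d i))" using 1 2 by blast
next
  fix f i Q assume "Q \<in> open_cubes n d i" "f \<in> Q"
  show "f \<in> torus n d"
  proof -
    obtain S a where Q: "Q = PiE {..<d} (\<lambda>j. cube_factor n (j \<in> S) (a j))"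
      using \<open>Q \<in> open_cubes n d i\<close> unfolding open_cubes_def by blast
    have "cube_factor n b c \<subseteq> UNIV // circle_rel n" for b c
      by (auto simp: cube_factor_def circle_proj_def intro: quotientI)
    then have "Q \<subseteq> torus n d" unfolding torus_def Q by (intro PiE_mono)
    then show ?thesis using \<open>f \<in> Q\<close> by (rule subsetD)
  qed
qed

lemma plaquette_model_exists:
  fixes p :: real
  assumes "n \<ge> 2" "0 \<le> p" "p \<le> 1"
  shows "\<exists>(M :: ((nat \<Rightarrow> real set) set \<Rightarrow> bool) measure) C. plaquette_model M n d p C"
proof (intro exI)
  let ?N = "Pi_pmf (open_cubes n d d) False (\<lambda>_. bernoulli_pmf p)"
  let ?L = "\<Union>i<d. open_cubes n d i"
  define C where "C = (\<lambda>\<omega>. \<Union>(?L \<union> {Q \<in> open_cubes n d d. \<omega> Q}))"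
  have fin: "finite (open_cubes n d d)" using assms by (intro finite_open_cubes) auto
  have C_iff: "Q \<subseteq> C \<omega> \<longleftrightarrow> \<omega> Q" if Q: "Q \<in> open_cubes n d d" for Q \<omega>
  proof
    assume sub: "Q \<subseteq> C \<omega>"
    obtain f where f: "f \<in> Q" using open_cube_nonempty[OF Q] by blast
    then obtain R where R: "f \<in> R" "R \<in> ?L \<union> {Q \<in> open_cubes n d d. \<omega> Q}"
      using sub unfolding C_def by blast
    then show "\<omega> Q" using open_cube_disjoint[OF Q _ f R(1)] by blast
  qed (use Q in \<open>auto simp: C_def\<close>)
  have "prob_space.indep_events ?N (\<lambda>Q. {\<omega> \<in> space (measure_pmf ?N). \<omega> Q}) (open_cubes n d d)"
    using prob_space.indep_eventsI_indep_vars[OF measure_pmf.prob_space_axioms indep_vars_Pi_pmf[OF fin], of "\<lambda>_ b. b"] by simp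
  moreover have "prob_space.indep_events ?N (\<lambda>Q. {\<omega> \<in> space (measure_pmf ?N). Q \<subseteq> C \<omega>}) (open_cubes n d d) =
      prob_space.indep_events ?N (\<lambda>Q. {\<omega> \<in> space (measure_pmf ?N). \<omega> Q}) (open_cubes n d d)"
    unfolding prob_space.indep_events_def_alt[OF measure_pmf.prob_space_axioms]
    by (intro prob_space.indep_sets_cong[OF measure_pmf.prob_space_axioms]) (simp_all add: C_iff)
  ultimately have "prob_space.indep_events ?N (\<lambda>Q. {\<omega> \<in> space (measure_pmf ?N). Q \<subseteq> C \<omega>}) (open_cubes n d d)"
    by simp
  moreover have "measure_pmf.prob ?N {\<omega> \<in> space (measure_pmf ?N). Q \<subseteq> C \<omega>} = p" if Q: "Q \<in> open_cubes n d d" for Q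
  proof -
    have "measure_pmf.prob ?N {\<omega> \<in> space (measure_pmf ?N). Q \<subseteq> C \<omega>} =
          measure_pmf.prob (map_pmf (\<lambda>f. f Q) ?N) {True}"
      using C_iff[OF Q] by (simp add: vimage_def)
    also have "\<dots> = p" using assms Q by (simp add: Pi_pmf_component[OF fin] measure_pmf_single)
    finally show ?thesis .
  qed
  moreover have "union_of_cubes n d (C \<omega>)" for \<omega>
    unfolding union_of_cubes_def
    by (intro exI[of _ "?L \<union> {Q \<in> open_cubes n d d. \<omega> Q}"] conjI)
       (auto simp: C_def intro: less_imp_le)
  moreover have "Q \<subseteq> C \<omega>" if "i < d" "Q \<in> open_cubes n d i" for i Q \<omega>
    using that by (auto simp: C_def)
  ultimately show "plaquette_model (measure_pmf ?N) n d p C"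
    unfolding plaquette_model_def using measure_pmf.prob_space_axioms by blast
qed

end

theory Submission
  imports Defs
begin

text \<open>In the plaquette model \<open>\<mu>\<^sub>k(C)\<close> is a constant, contributed by the cubes of dimension
  less than \<open>d\<close>, plus \<open>(-1)\<^bsup>d-k\<^esup> (d choose k)\<close> times a binomial random variable with \<open>n\<^sup>d\<close>
  trials. The constant is obtained from \<open>\<mu>\<^sub>k(torus) = n\<^sup>d [k = d]\<close>, an alternating binomial
  sum over all dimensions, by removing the term of dimension \<open>d\<close>.\<close>

text \<open>Trinomial revision, \<open>(d choose i) * (i choose k) = (d choose k) * (d - k choose (i
  - k))\<close>, pulls out the factor \<open>d choose k\<close> and leaves the alternating sum of
  row \<open>d - k\<close> of Pascal's triangle, which is zero unless that row is row 0.\<close>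

lemma alternating_sum_choose_mult:
  assumes "k \<le> d"
  shows "(\<Sum>i\<le>d. real (d choose i) * ((-1) ^ (i - k) * real (i choose k))) =
         (if k = d then 1 else 0)"
proof -
  have "(\<Sum>i\<le>d. real (d choose i) * ((-1) ^ (i - k) * real (i choose k))) =
        (\<Sum>i\<in>{k..d}. real (d choose i) * ((-1) ^ (i - k) * real (i choose k)))"
    \<comment> \<open>The terms with \<open>i < k\<close>, whose exponent is truncated, vanish
      through \<open>i choose k\<close>.\<close>
    by (rule sum.mono_neutral_right) auto
  also have "\<dots> = (\<Sum>j\<le>d - k. real (d choose k) * ((-1) ^ j * real (d - k choose j)))"
  proof (rule sum.reindex_bij_witness[of _ "\<lambda>j. j + k" "\<lambda>i. i - k"])
    fix i assume "i \<in> {k..d}"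
    then have "real (d choose i) * real (i choose k) =
               real (d choose k) * real (d - k choose (i - k))"
      using choose_mult[of k i d] by (simp flip: of_nat_mult)
    then show "real (d choose k) * ((-1) ^ (i - k) * real (d - k choose (i - k))) =
               real (d choose i) * ((-1) ^ (i - k) * real (i choose k))"
      by (simp add: mult_ac)
  qed (use assms in auto)
  also have "\<dots> = (if k = d then 1 else 0)"
    using choose_alternating_sum[of "d - k", where 'a = real] assms
    by (auto simp flip: sum_distrib_left)
  finally show ?thesis .
qed

text \<open>A common point of both factors has a real representative in each of the two underlying
  sets. These differ by a multiple of \<open>n\<close>, and so do their floors, which are
  \<open>a\<close> and \<open>a'\<close>.\<close>

lemma cube_factor_eq_iff:
  "cube_factor n b a = cube_factor n b' a' \<longleftrightarrow> b = b' \<and> (\<exists>m. a' = a + m * int n)"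
proof
  assume eq: "cube_factor n b a = cube_factor n b' a'"
  let ?I = "\<lambda>b a. if b then {of_int a<..<of_int a + 1} else {of_int a} :: real set"
  have "(if b then of_int a + 1 / 2 else of_int a) \<in> ?I b a" by auto
  then obtain x where x: "x \<in> ?I b a" by blast
  then have t: "circle_proj n x \<in> cube_factor n b a" by (simp add: cube_factor_def)
  then obtain y where y: "y \<in> ?I b' a'" "circle_proj n x = circle_proj n y"
    unfolding eq by (auto simp: cube_factor_def)
  obtain m :: int where "y = x + of_int m * of_nat n"
    using y(2) circle_proj_eq_iff by blast
  then have "y = x + of_int (m * int n)" by simp
  then have "a' = a + m * int n"
    using factor_floor(1)[OF x] factor_floor(1)[OF y(1)] floor_add_int[of x "m * int n"] by simp
  moreover have "b = b'" using cube_factor_disjoint t eq by blast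
  ultimately show "b = b' \<and> (\<exists>m. a' = a + m * int n)" by blast
qed (use cube_factor_shift in auto)

text \<open>A cube is determined by the set \<open>S\<close> of directions in which it is an
  interval and by its base corner modulo \<open>n\<close>: there are \<open>d choose i\<close>
  choices for the first and \<open>n ^ d\<close> for the second.\<close>

lemma card_open_cubes:
  assumes "n > 0"
  shows "card (open_cubes n d i) = (d choose i) * n ^ d"
proof -
  let ?P = "{S. S \<subseteq> {..<d} \<and> card S = i} \<times> PiE {..<d} (\<lambda>_. {0..<int n})"
  let ?cube = "\<lambda>(S, a). PiE {..<d} (\<lambda>j. cube_factor n (j \<in> S) (a j))"
  have "inj_on ?cube ?P"
  proof (rule inj_onI, clarsimp)
    fix S T a b
    assume S: "S \<subseteq> {..<d}" and T: "T \<subseteq> {..<d}"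
      and a: "a \<in> PiE {..<d} (\<lambda>_. {0..<int n})" and b: "b \<in> PiE {..<d} (\<lambda>_. {0..<int n})"
      and eq: "PiE {..<d} (\<lambda>j. cube_factor n (j \<in> S) (a j)) =
               PiE {..<d} (\<lambda>j. cube_factor n (j \<in> T) (b j))"
    \<comment> \<open>Products of nonempty sets are equal only if they agree factor by
      factor.\<close>
    have ne: "cube_factor n c x \<noteq> {}" for c x by (simp add: cube_factor_def)
    have *: "(j \<in> S \<longleftrightarrow> j \<in> T) \<and> (\<exists>m. b j = a j + m * int n)" if "j < d" for j
      using eq that ne by (simp add: PiE_eq_iff_not_empty cube_factor_eq_iff)
    have "a j = b j" if j: "j < d" for j
    proof -
      have "a j mod int n = b j mod int n" using *[OF j] by auto
      then show ?thesis using PiE_mem[OF a, of j] PiE_mem[OF b, of j] j by simp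
    qed
    then have "a = b" by (intro PiE_ext[OF a b]) simp
    moreover have "S = T" using * S T by auto
    ultimately show "S = T \<and> a = b" by simp
  qed
  moreover have "?cube ` ?P = open_cubes n d i"
  proof
    show "?cube ` ?P \<subseteq> open_cubes n d i" by (auto simp: open_cubes_def)
    show "open_cubes n d i \<subseteq> ?cube ` ?P"
    proof
      fix Q assume "Q \<in> open_cubes n d i"
      then obtain S a where Q: "Q = PiE {..<d} (\<lambda>j. cube_factor n (j \<in> S) (a j))"
        and S: "S \<subseteq> {..<d}" "card S = i"
        unfolding open_cubes_def by blast
      \<comment> \<open>The corner \<open>a\<close> is an arbitrary function; its representative in
        \<open>?P\<close> is reduced modulo \<open>n\<close> and restricted to
        \<open>{..<d}\<close>.\<close>
      let ?r = "\<lambda>j\<in>{..<d}. a j mod int n"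
      have "cube_factor n c (x mod int n) = cube_factor n c x" for c x
        using cube_factor_shift[of n c "x mod int n" "x div int n"] by simp
      then have "Q = ?cube (S, ?r)" unfolding Q by (auto intro!: PiE_cong)
      moreover have "(S, ?r) \<in> ?P" using S assms by auto
      ultimately show "Q \<in> ?cube ` ?P" by (rule image_eqI)
    qed
  qed
  ultimately have "bij_betw ?cube ?P (open_cubes n d i)" unfolding bij_betw_def by (rule conjI)
  then have "card (open_cubes n d i) = card ?P" by (rule bij_betw_same_card[symmetric])
  also have "\<dots> = (d choose i) * n ^ d"
    using n_subsets[of "{..<d}" i] by (simp add: card_cartesian_product card_PiE)
  finally show ?thesis .
qed

context prob_space
begin

lemma integrable_sum_indicator:
  assumes "\<And>i. i \<in> I \<Longrightarrow> A i \<in> events"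
  shows "integrable M (\<lambda>x. \<Sum>i\<in>I. indicator (A i) x :: real)"
  using assms by (intro Bochner_Integration.integrable_sum integrable_real_indicator) (auto simp: emeasure_eq_measure)

lemma expectation_sum_indicator:
  assumes "\<And>i. i \<in> I \<Longrightarrow> A i \<in> events"
  shows "expectation (\<lambda>x. \<Sum>i\<in>I. indicator (A i) x) = (\<Sum>i\<in>I. prob (A i))"
  using assms by (subst Bochner_Integration.integral_sum) (auto simp: emeasure_eq_measure)

text \<open>The squared sum expands into indicators of pairwise intersections. By independence the
  second moment is the square of the expectation plus a correction from the diagonal, where
  \<open>A i \<inter> A i\<close> has probability \<open>prob (A i)\<close> instead of its
  square.\<close>

lemma variance_sum_indicator:
  assumes fin: "finite I" and indep: "indep_events A I"
  shows "variance (\<lambda>x. \<Sum>i\<in>I. indicator (A i) x) = (\<Sum>i\<in>I. prob (A i) - (prob (A i))\<^sup>2)"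
proof -
  have ev: "A i \<in> events" if "i \<in> I" for i
    using indep that by (auto simp: indep_events_def)
  have prob_Int: "prob (A i \<inter> A j) = prob (A i) * prob (A j) +
      (if i = j then prob (A i) - (prob (A i))\<^sup>2 else 0)" if "i \<in> I" "j \<in> I" for i j
  proof (cases "i = j")
    case False
    then show ?thesis
      using indep[unfolded indep_events_def, THEN conjunct2, rule_format, of "{i, j}"] that by simp
  qed (simp add: power2_eq_square)
  have sq: "(\<Sum>i\<in>I. indicator (A i) x)\<^sup>2 =
      (\<Sum>i\<in>I. \<Sum>j\<in>I. indicator (A i \<inter> A j) x :: real)" for x
    by (simp add: power2_eq_square sum_product indicator_inter_arith)
  have int: "integrable M (indicator (A i \<inter> A j) :: _ \<Rightarrow> real)" if "i \<in> I" "j \<in> I" for i j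
    using ev that by (intro integrable_real_indicator) (auto simp: emeasure_eq_measure)
  have "expectation (\<lambda>x. (\<Sum>i\<in>I. indicator (A i) x)\<^sup>2) = (\<Sum>i\<in>I. \<Sum>j\<in>I. prob (A i \<inter> A j))"
    unfolding sq using ev int
    by (simp add: Bochner_Integration.integral_sum Bochner_Integration.integrable_sum)
  also have "\<dots> = (\<Sum>i\<in>I. prob (A i))\<^sup>2 + (\<Sum>i\<in>I. prob (A i) - (prob (A i))\<^sup>2)"
    using fin by (simp add: prob_Int sum.distrib sum_product power2_eq_square)
  finally have "expectation (\<lambda>x. (\<Sum>i\<in>I. indicator (A i) x)\<^sup>2) =
      (\<Sum>i\<in>I. prob (A i))\<^sup>2 + (\<Sum>i\<in>I. prob (A i) - (prob (A i))\<^sup>2)" .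
  moreover have "integrable M (\<lambda>x. (\<Sum>i\<in>I. indicator (A i) x :: real)\<^sup>2)"
    unfolding sq by (intro Bochner_Integration.integrable_sum int)
  ultimately show ?thesis
    using variance_eq[OF integrable_sum_indicator[of I A]] expectation_sum_indicator[of I A] ev
    by simp
qed

end

text \<open>This makes the intrinsic volume an affine function of the number of top-dimensional
  cubes, the only random quantity.\<close>

lemma intrinsic_volume_eq:
  assumes "n > 0" and "k \<le> d"
    and lower: "\<And>i Q. i < d \<Longrightarrow> Q \<in> open_cubes n d i \<Longrightarrow> Q \<subseteq> C"
  shows "intrinsic_volume n d k C =
         real n ^ d * ((if k = d then 1 else 0) - cube_intrinsic_volume d k) +
         cube_intrinsic_volume d k * real (card {Q \<in> open_cubes n d d. Q \<subseteq> C})"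
proof -
  let ?v = "\<lambda>i. cube_intrinsic_volume i k"
  have all: "{Q \<in> open_cubes n d i. Q \<subseteq> C} = open_cubes n d i" if "i < d" for i
    using lower that by blast
  have "(\<Sum>i\<le>d. real (d choose i) * ?v i) = (if k = d then 1 else 0)"
    using alternating_sum_choose_mult[OF assms(2)] by (simp add: cube_intrinsic_volume_def)
  then have "(\<Sum>i<d. real (d choose i) * ?v i) = (if k = d then 1 else 0) - ?v d"
    by (simp flip: lessThan_Suc_atMost)
  moreover have "(\<Sum>i<d. real (card {Q \<in> open_cubes n d i. Q \<subseteq> C}) * ?v i) =
                 real n ^ d * (\<Sum>i<d. real (d choose i) * ?v i)"
    by (simp add: all card_open_cubes[OF assms(1)] sum_distrib_left mult_ac)
  ultimately show ?thesis
    unfolding intrinsic_volume_def by (simp flip: lessThan_Suc_atMost)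
qed

theorem proposition13:
  fixes d n k :: nat and p :: real
    and M :: "'a measure" and C :: "'a \<Rightarrow> (nat \<Rightarrow> real set) set"
  assumes "n \<ge> 2" and "k \<le> d" and "0 \<le> p" and "p \<le> 1"
    and "plaquette_model M n d p C"
  shows "1 / real n ^ d * prob_space.expectation M (\<lambda>\<omega>. intrinsic_volume n d k (C \<omega>)) =
           (if k < d then (-1) ^ (d - k) * real (d choose k) * (p - 1) else p) \<and>
         1 / real n ^ d * prob_space.variance M (\<lambda>\<omega>. intrinsic_volume n d k (C \<omega>)) =
           (real (d choose k))\<^sup>2 * (p - p\<^sup>2)"
proof -
  interpret prob_space M using assms(5) by (simp add: plaquette_model_def)
  let ?I = "open_cubes n d d"
  let ?A = "\<lambda>Q. {\<omega> \<in> space M. Q \<subseteq> C \<omega>}"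
  \<comment> \<open>The number of \<open>d\<close>-cubes in \<open>C\<close>, as a sum of
    independent indicators of probability \<open>p\<close>.\<close>
  let ?N = "\<lambda>\<omega>. \<Sum>Q\<in>?I. indicator (?A Q) \<omega> :: real"
  define v where "v = cube_intrinsic_volume d k"
  define c where "c = real n ^ d * ((if k = d then 1 else 0) - v)"
  have n: "n > 0" using assms(1) by simp
  have fin: "finite ?I" using n by (rule finite_open_cubes)
  have card: "card ?I = n ^ d" using card_open_cubes[OF n] by simp
  have indep: "indep_events ?A ?I" and prob: "\<And>Q. Q \<in> ?I \<Longrightarrow> prob (?A Q) = p"
    using assms(5) by (auto simp: plaquette_model_def)
  have ev: "?A Q \<in> events" if "Q \<in> ?I" for Q
    using indep that by (auto simp: indep_events_def)
  \<comment> \<open>The model constrains \<open>C\<close> on \<open>space M\<close> only, so this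
    identity enters the integrals below through \<open>integral_cong\<close>.\<close>
  have eq: "intrinsic_volume n d k (C \<omega>) = c + v * ?N \<omega>" if \<omega>: "\<omega> \<in> space M" for \<omega>
  proof -
    have "?N \<omega> = real (card {Q \<in> ?I. Q \<subseteq> C \<omega>})"
      using \<omega> fin by (simp add: indicator_def sum.If_cases Int_def)
    moreover have "Q \<subseteq> C \<omega>" if "i < d" "Q \<in> open_cubes n d i" for i Q
      using assms(5) \<omega> that unfolding plaquette_model_def by blast
    ultimately show ?thesis
      unfolding c_def v_def using intrinsic_volume_eq[OF n assms(2)] by simp
  qed
  have int: "integrable M ?N" using ev by (rule integrable_sum_indicator)
  have exp_N: "expectation ?N = real n ^ d * p"
    using expectation_sum_indicator[of ?I ?A] ev prob card by simp
  have var_N: "variance ?N = real n ^ d * (p - p\<^sup>2)"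
    using variance_sum_indicator[OF fin indep] prob card by simp
  have E: "expectation (\<lambda>\<omega>. intrinsic_volume n d k (C \<omega>)) = c + v * (real n ^ d * p)"
  proof -
    have "expectation (\<lambda>\<omega>. intrinsic_volume n d k (C \<omega>)) = expectation (\<lambda>\<omega>. c + v * ?N \<omega>)"
      by (rule Bochner_Integration.integral_cong) (simp_all only: eq)
    also have "\<dots> = c + v * expectation ?N"
      using int by (simp add: prob_space)
    finally show ?thesis unfolding exp_N .
  qed
  \<comment> \<open>Centering cancels the constant \<open>c\<close>, and squaring turns the factor
    \<open>v\<close> into \<open>v\<^sup>2\<close>, which also removes its sign.\<close>
  have "variance (\<lambda>\<omega>. intrinsic_volume n d k (C \<omega>)) =
        expectation (\<lambda>\<omega>. v\<^sup>2 * (?N \<omega> - expectation ?N)\<^sup>2)"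
    unfolding E exp_N
    by (rule Bochner_Integration.integral_cong)
       (simp_all only: eq power_mult_distrib[symmetric], simp add: algebra_simps)
  also have "\<dots> = v\<^sup>2 * (real n ^ d * (p - p\<^sup>2))" using var_N by simp
  finally have V: "variance (\<lambda>\<omega>. intrinsic_volume n d k (C \<omega>)) =
      v\<^sup>2 * (real n ^ d * (p - p\<^sup>2))" .
  have "v\<^sup>2 = (real (d choose k))\<^sup>2"
    by (simp add: v_def cube_intrinsic_volume_def power_mult_distrib flip: power_mult)
  \<comment> \<open>For \<open>k < d\<close> the constant \<open>c\<close> is
    \<open>- v * real n ^ d\<close>, which yields the factor \<open>p - 1\<close>; for
    \<open>k = d\<close> one has \<open>v = 1\<close> and \<open>c = 0\<close>.\<close>
  moreover have "c + v * (real n ^ d * p) =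
      real n ^ d * (if k < d then (-1) ^ (d - k) * real (d choose k) * (p - 1) else p)"
    using assms(2) by (auto simp: c_def v_def cube_intrinsic_volume_def algebra_simps)
  ultimately show ?thesis unfolding V unfolding E using n by simp
qed

end
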